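(* Let $\rho,l,k_0,c_0,h>0$, $T_0>0$, $T_f<T_0$, $\delta\ge 0$, $p\ge 0$, and put $a=\sqrt{k_0/(\rho c_0)}$, $\mathrm{Ste}=c_0(T_0-T_f)/l$, $\gamma=2ha/k_0$. The one-phase Stefan problem with Robin condition (find $T=T(x,t)$ and $x=s(t)$) $$\rho\, c(T)\frac{\partial T}{\partial t}=\frac{\partial}{\partial x}\Big(k(T)\frac{\partial T}{\partial x}\Big),\quad 0<x<s(t),\ t>0,$$ $$k(T(0,t))\frac{\partial T}{\partial x}(0,t)=\frac{h}{\sqrt t}\big(T(0,t)-T_0\big),\quad t>0,$$ $$T(s(t),t)=T_f,\qquad k_0\frac{\partial T}{\partial x}(s(t),t)=-\rho\, l\,\dot s(t),\quad t>0,\qquad s(0)=0,$$ has a unique similarity type solution, and it is given by $$T_\gamma(x,t)=(T_0-T_f)\,y_\gamma\Big(\frac{x}{2a\sqrt t}\Big)+T_f,\quad 0<x<s_\gamma(t),\ t>0,\qquad s_\gamma(t)=2a\lambda_\gamma\sqrt t,\quad t>0,$$ where $(y_\gamma,\lambda_\gamma)$, with $\lambda_\gamma>0$ and $y_\gamma\ge 0$, is the unique solution to the functional problem $$\frac{\mathrm{Ste}}{\sqrt\pi}\,F(\beta_\gamma(\lambda_\gamma))=\lambda_\gamma\exp(\lambda_\gamma^2)\,\mathrm{erf}(\lambda_\gamma),\qquad 0<\lambda_\gamma\le\lambda_0,$$ $$F(y_\gamma(\eta))=\frac{\sqrt\pi}{\mathrm{Ste}}\,\lambda_\gamma\exp(\lambda_\gamma^2)\big(\mathrm{erf}(\lambda_\gamma)-\mathrm{erf}(\eta)\big),\quad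 0<\eta<\lambda_\gamma.$$
   Context: The thermal conductivity and specific heat are $$k(T)=k_0\Big(1+\delta\Big(\frac{T-T_f}{T_0-T_f}\Big)^p\Big),\qquad c(T)=c_0\Big(1+\delta\Big(\frac{T-T_f}{T_0-T_f}\Big)^p\Big),$$ where $k_0=k(T_f)$ and $c_0=c(T_f)$ are the reference thermal conductivity and specific heat. $\rho$ is the density, $l$ the latent heat per unit mass, $h$ the thermal transfer coefficient, $T_0$ the bulk temperature, $T_f$ the phase change temperature. A similarity type solution is a solution $(T,s)$ (equations understood in the classical sense) of the form $T(x,t)=(T_0-T_f)\,y(\eta)+T_f$ with $\eta=x/(2a\sqrt t)$ and $s(t)=2a\lambda\sqrt t$, for some parameter $\lambda>0$ and some function $y\ge 0$ of the single variable $\eta\in[0,\lambda]$. Moreover $$F(x)=x+\frac{\delta}{p+1}x^{p+1}\ (x\ge 0),\qquad \beta_\gamma(x)=1-\frac{2x\exp(x^2)}{\gamma\,\mathrm{Ste}}\ \ (0\le x\le\lambda_0),$$ where $\lambda_0=\beta_\gamma^{-1}(0)$ is the unique positive number with $2\lambda_0\exp(\lambda_0^2)=\gamma\,\mathrm{Ste}$, and $\mathrm{erf}(x)=\frac{2}{\sqrt\pi}\int_0^x e^{-u^2}\,du$. *)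

theory Defs
  imports "HOL-Analysis.Analysis"
begin

text \<open>
  Real power of a nonnegative base with the usual convention \<open>0^0 = 1\<close>;
  the library has \<open>0 powr 0 = 0\<close>. Consequently the standing identities \<open>k T_f = k0\<close> and
  \<open>c T_f = c0\<close> (the reference values are those at the phase change temperature) are automatic
  for \<open>p > 0\<close>, while for \<open>p = 0\<close> they hold only if \<open>\<delta> = 0\<close>.
\<close>

definition rpow :: "real \<Rightarrow> real \<Rightarrow> real" where
  "rpow x p = (if p = 0 then 1 else x powr p)"

text \<open>Common shape of the conductivity (\<open>q = k0\<close>) and of the specific heat (\<open>q = c0\<close>).\<close>

definition thermal_coeff :: "real \<Rightarrow> real \<Rightarrow> real \<Rightarrow> real \<Rightarrow> real \<Rightarrow> real \<Rightarrow> real" where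
  "thermal_coeff q \<delta> p T0 Tf T = q * (1 + \<delta> * rpow ((T - Tf) / (T0 - Tf)) p)"

definition erf :: "real \<Rightarrow> real" where
  "erf x = 2 / sqrt pi * (LBINT u=0..x. exp (- u\<^sup>2))"

definition F_fun :: "real \<Rightarrow> real \<Rightarrow> real \<Rightarrow> real" where
  "F_fun \<delta> p x = x + \<delta> / (p + 1) * x powr (p + 1)"

definition beta_fun :: "real \<Rightarrow> real \<Rightarrow> real \<Rightarrow> real" where
  "beta_fun \<gamma> Ste x = 1 - 2 * x * exp (x\<^sup>2) / (\<gamma> * Ste)"

definition lambda0 :: "real \<Rightarrow> real \<Rightarrow> real" where
  "lambda0 \<gamma> Ste = (THE x. x > 0 \<and> 2 * x * exp (x\<^sup>2) = \<gamma> * Ste)"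

text \<open>
  Classical solutions of the one-phase Stefan problem with Robin condition. Only the values of
  \<open>T x t\<close> for \<open>t > 0\<close>, \<open>0 \<le> x \<le> s t\<close> matter. \<open>Tx\<close> is the spatial derivative of \<open>T\<close>,
  one-sided at \<open>x = 0\<close> and \<open>x = s t\<close>.
\<close>

definition stefan_solution ::
  "(real \<Rightarrow> real) \<Rightarrow> (real \<Rightarrow> real) \<Rightarrow> real \<Rightarrow> real \<Rightarrow> real \<Rightarrow> real \<Rightarrow> real \<Rightarrow> real
    \<Rightarrow> (real \<Rightarrow> real \<Rightarrow> real) \<Rightarrow> (real \<Rightarrow> real) \<Rightarrow> bool" where
  "stefan_solution k c \<rho> l k0 h T0 Tf T s \<longleftrightarrow>
     s 0 = 0 \<and> (\<forall>t>0. s t > 0) \<and>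
     (\<exists>Tx :: real \<Rightarrow> real \<Rightarrow> real.
        (\<forall>t>0. \<forall>x\<in>{0..s t}.
           ((\<lambda>z. T z t) has_real_derivative Tx x t) (at x within {0..s t})) \<and>
        (\<forall>t>0. \<forall>x\<in>{0<..<s t}. \<exists>Tt.
           ((\<lambda>\<tau>. T x \<tau>) has_real_derivative Tt) (at t) \<and>
           ((\<lambda>z. k (T z t) * Tx z t) has_real_derivative \<rho> * c (T x t) * Tt) (at x)) \<and>
        (\<forall>t>0. k (T 0 t) * Tx 0 t = h / sqrt t * (T 0 t - T0)) \<and>
        (\<forall>t>0. T (s t) t = Tf) \<and>
        (\<forall>t>0. \<exists>ds. (s has_real_derivative ds) (at t) \<and> k0 * Tx (s t) t = - \<rho> * l * ds))"

definition similarity_type ::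
  "real \<Rightarrow> real \<Rightarrow> real \<Rightarrow> (real \<Rightarrow> real \<Rightarrow> real) \<Rightarrow> (real \<Rightarrow> real) \<Rightarrow> bool" where
  "similarity_type a T0 Tf T s \<longleftrightarrow>
     (\<exists>y :: real \<Rightarrow> real. \<exists>lam>0.
        (\<forall>\<eta>\<in>{0..lam}. y \<eta> \<ge> 0) \<and>
        (\<forall>t>0. s t = 2 * a * lam * sqrt t) \<and>
        (\<forall>t>0. \<forall>x\<in>{0..s t}. T x t = (T0 - Tf) * y (x / (2 * a * sqrt t)) + Tf))"

text \<open>The functional problem constrains \<open>y\<close> only on the open interval \<open>{0<..<lam}\<close>.\<close>

definition functional_problem ::
  "real \<Rightarrow> real \<Rightarrow> real \<Rightarrow> real \<Rightarrow> (real \<Rightarrow> real) \<Rightarrow> real \<Rightarrow> bool" where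
  "functional_problem \<delta> p \<gamma> Ste y lam \<longleftrightarrow>
     0 < lam \<and> lam \<le> lambda0 \<gamma> Ste \<and>
     Ste / sqrt pi * F_fun \<delta> p (beta_fun \<gamma> Ste lam) = lam * exp (lam\<^sup>2) * erf lam \<and>
     (\<forall>\<eta>\<in>{0<..<lam}. y \<eta> \<ge> 0 \<and>
        F_fun \<delta> p (y \<eta>) = sqrt pi / Ste * lam * exp (lam\<^sup>2) * (erf lam - erf \<eta>))"

end

theory Submission
  imports Defs
begin

text \<open>
  In the variable \<open>\<eta> = x / (2 a \<surd>t)\<close> the Stefan problem for a similarity solution turns into a
  boundary value problem for \<open>y\<close> on \<open>{0..\<lambda>}\<close> with unknown end point \<open>\<lambda>\<close>. Conductivity and specific
  heat depend on the temperature through the same factor \<open>\<phi> v = 1 + \<delta> v^p\<close>, and therefore the heat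
  equation reads \<open>(\<phi>(y) y')' = - 2 \<eta> \<phi>(y) y'\<close>: it is a linear first-order equation for the flux
  \<open>\<phi>(y) y'\<close> alone. Since \<open>\<phi> = F'\<close>, the flux is the derivative of \<open>F \<circ> y\<close> (the Kirchhoff transform),
  and two integrations give \<open>F (y \<eta>) = A + B erf \<eta>\<close> (lemma \<open>gaussian_decay_imp_erf\<close>).

  Three boundary conditions are left for the three unknowns \<open>A, B, \<lambda>\<close>. The conditions
  \<open>y \<lambda> = 0\<close> and \<open>y' \<lambda> = - 2 \<lambda> / Ste\<close> at the front determine \<open>A\<close> and \<open>B\<close> in terms of \<open>\<lambda>\<close>, and the
  Robin condition then says \<open>y 0 = \<beta> \<lambda>\<close>. Evaluating \<open>F (y 0)\<close> in two ways yields the equation for \<open>\<lambda>\<close>,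
  and \<open>y 0 \<ge> 0\<close> is the constraint \<open>\<lambda> \<le> \<lambda>\<^sub>0\<close> (lemma \<open>profile_imp_functional\<close>). All steps can be
  reversed, because \<open>F\<close> is a bijection of the half-line with \<open>F' \<ge> 1\<close>
  (lemma \<open>functional_imp_profile\<close>). The passage between the partial differential equation and the
  boundary value problem is the chain rule (lemmas \<open>profile_imp_stefan_solution\<close> and
  \<open>stefan_solution_imp_profile\<close>). Finally, the equation for \<open>\<lambda>\<close> equates a strictly decreasing with a
  nondecreasing function and has exactly one root (lemma \<open>ex1_front_eq\<close>).
\<close>

section \<open>Calculus on intervals\<close>

lemma has_real_derivative_unique_Icc:
  fixes f :: "real \<Rightarrow> real"
  assumes "a < b" "x \<in> {a..b}"
    and "(f has_real_derivative D) (at x within {a..b})"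
    and "(f has_real_derivative D') (at x within {a..b})"
  shows "D = D'"
  using vector_derivative_unique_within_closed_interval[of a b x f D D'] assms
  by (simp add: has_real_derivative_iff_has_vector_derivative)

text \<open>
  When \<open>y\<close> is given implicitly by \<open>F (y z) = V z\<close>, the chain rule suggests \<open>y' = V' / F'\<close>. The
  difference quotients of \<open>F\<close> and \<open>V\<close> (their Caratheodory slopes) can be divided, because the slope
  of \<open>F\<close> stays away from \<open>0\<close> near the point; no inverse function of \<open>F\<close> has to be chosen.
\<close>

lemma has_field_derivative_implicit_within:
  fixes F V y :: "real \<Rightarrow> real"
  assumes F: "(F has_real_derivative d) (at (y x) within U)" and d: "d \<noteq> 0"
    and y: "continuous (at x within S) y" "y ` S \<subseteq> U"
    and V: "(V has_real_derivative v) (at x within S)"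
    and eq: "\<And>z. z \<in> S \<Longrightarrow> F (y z) = V z" and x: "x \<in> S"
  shows "(y has_real_derivative v / d) (at x within S)"
proof -
  obtain g where g: "\<And>z. F z - F (y x) = g z * (z - y x)"
      "continuous (at (y x) within U) g" "g (y x) = d"
    using F unfolding DERIV_caratheodory_within by blast
  have "continuous (at (y x) within y ` S) g"
    using g(2) y(2) continuous_within_subset by blast
  then have "continuous (at x within S) (g \<circ> y)"
    using y(1) continuous_within_compose by blast
  then have lim_g: "((\<lambda>z. g (y z)) \<longlongrightarrow> d) (at x within S)"
    using g(3) by (simp add: continuous_within o_def)
  have lim_V: "((\<lambda>z. (V z - V x) / (z - x)) \<longlongrightarrow> v) (at x within S)"
    using V by (simp add: has_field_derivative_iff)
  have "\<forall>\<^sub>F z in at x within S. g (y z) \<noteq> 0"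
    using tendsto_imp_eventually_ne[OF lim_g d] .
  moreover have "\<forall>\<^sub>F z in at x within S. z \<in> S \<and> z \<noteq> x"
    by (simp add: eventually_at_filter)
  ultimately have "\<forall>\<^sub>F z in at x within S.
      (V z - V x) / (z - x) / g (y z) = (y z - y x) / (z - x)"
  proof eventually_elim
    case (elim z)
    then have "V z - V x = g (y z) * (y z - y x)"
      using g(1)[of "y z"] eq[of z] eq[OF x] by simp
    then show ?case using elim by simp
  qed
  then have "((\<lambda>z. (y z - y x) / (z - x)) \<longlongrightarrow> v / d) (at x within S)"
    using tendsto_divide[OF lim_V lim_g d] by (rule Lim_transform_eventually[rotated])
  then show ?thesis by (simp add: has_field_derivative_iff)
qed

section \<open>The error function\<close>

lemma DERIV_erf: "(erf has_real_derivative 2 / sqrt pi * exp (- x\<^sup>2)) (at x)"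
proof -
  let ?a = "min 0 x - 1" and ?b = "max 0 x + 1"
  let ?I = "\<lambda>u. LBINT y=ereal 0..ereal u. exp (- y\<^sup>2)"
  have "(?I has_vector_derivative exp (- x\<^sup>2)) (at x within {?a..?b})"
    by (rule interval_integral_FTC2) (auto intro!: continuous_intros)
  moreover have "at x within {?a..?b} = at x"
    by (rule at_within_Icc_at) auto
  ultimately have "(?I has_real_derivative exp (- x\<^sup>2)) (at x)"
    by (simp add: has_real_derivative_iff_has_vector_derivative)
  from DERIV_cmult[OF this, of "2 / sqrt pi"] show ?thesis
    by (simp add: erf_def[abs_def] zero_ereal_def)
qed

lemma erf_0: "erf 0 = 0"
  by (simp add: erf_def flip: zero_ereal_def)

lemma erf_strict_mono: "x < y \<Longrightarrow> erf x < erf y"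
  by (rule DERIV_pos_imp_increasing) (auto intro!: exI DERIV_erf)

lemma erf_mono: "x \<le> y \<Longrightarrow> erf x \<le> erf y"
  using erf_strict_mono[of x y] by (cases "x = y") auto

lemma continuous_on_erf: "continuous_on S erf"
  using DERIV_erf DERIV_isCont continuous_at_imp_continuous_on by blast

text \<open>
  The decay law \<open>w' = - 2 \<eta> w\<close> for \<open>w = G'\<close> has the integrating factor \<open>exp (\<eta>\<^sup>2)\<close>, so \<open>w\<close> is a
  multiple of the derivative of \<open>erf\<close>. The law is only known in the open interval; since \<open>G\<close> is
  continuous up to the end points, the resulting formula for \<open>G\<close> nevertheless holds on all of it.
\<close>

lemma gaussian_decay_imp_erf:
  assumes ab: "a < b" and cont: "continuous_on {a..b} G"
    and G: "\<And>\<eta>. \<eta> \<in> {a<..<b} \<Longrightarrow> (G has_real_derivative w \<eta>) (at \<eta>)"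
    and w: "\<And>\<eta>. \<eta> \<in> {a<..<b} \<Longrightarrow> (w has_real_derivative - 2 * \<eta> * w \<eta>) (at \<eta>)"
  obtains A B where "\<And>\<eta>. \<eta> \<in> {a..b} \<Longrightarrow> G \<eta> = A + B * erf \<eta>"
proof -
  have "((\<lambda>z. w z * exp (z\<^sup>2)) has_real_derivative 0) (at \<eta> within {a<..<b})"
    if "\<eta> \<in> {a<..<b}" for \<eta>
    by (rule has_field_derivative_at_within)
       (auto intro!: derivative_eq_intros w[OF that] simp: algebra_simps)
  then obtain C where C: "\<And>\<eta>. \<eta> \<in> {a<..<b} \<Longrightarrow> w \<eta> * exp (\<eta>\<^sup>2) = C"
    using has_field_derivative_zero_constant[of "{a<..<b}" "\<lambda>z. w z * exp (z\<^sup>2)"] by auto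
  define B where "B = sqrt pi / 2 * C"
  define D where "D \<eta> = G \<eta> - B * erf \<eta>" for \<eta>
  have "(D has_real_derivative 0) (at \<eta>)" if "\<eta> \<in> {a<..<b}" for \<eta>
  proof -
    have "w \<eta> = C * exp (- \<eta>\<^sup>2)"
      using C[OF that] by (simp add: exp_minus field_simps)
    then show ?thesis
      unfolding D_def[abs_def] B_def
      by (auto intro!: derivative_eq_intros G[OF that] DERIV_erf)
  qed
  moreover have "continuous_on {a..b} D"
    unfolding D_def[abs_def] by (intro continuous_intros cont continuous_on_erf)
  ultimately have "D \<eta> = D a" if "\<eta> \<in> {a..b}" for \<eta>
    using DERIV_isconst2[OF ab] that by auto
  then have "G \<eta> = D a + B * erf \<eta>" if "\<eta> \<in> {a..b}" for \<eta>
    using that unfolding D_def by (metis diff_eq_eq add.commute)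
  then show ?thesis using that by blast
qed

section \<open>The functional problem\<close>

lemma x_exp_strict_mono:
  assumes "0 \<le> x" "x < (y::real)"
  shows "x * exp (x\<^sup>2) < y * exp (y\<^sup>2)"
proof -
  have "x\<^sup>2 < y\<^sup>2" using assms by (intro power_strict_mono) auto
  then show ?thesis using assms by (intro mult_strict_mono) auto
qed

text \<open>
  The dimensionless parameters. The assumption \<open>reference\<close> is what \<open>k Tf = k0\<close> amounts to; it makes
  \<open>\<phi> 0 = 1\<close>, and without it the conductivity at the front would not be \<open>k0\<close>.
\<close>

locale stefan_numbers =
  fixes \<delta> p \<gamma> Ste :: real
  assumes \<delta>_nonneg: "0 \<le> \<delta>" and p_nonneg: "0 \<le> p"
    and reference: "p = 0 \<Longrightarrow> \<delta> = 0"
    and \<gamma>_pos: "0 < \<gamma>" and Ste_pos: "0 < Ste"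
begin

definition \<phi> :: "real \<Rightarrow> real" where
  "\<phi> v = 1 + \<delta> * rpow v p"

abbreviation F :: "real \<Rightarrow> real" where
  "F \<equiv> F_fun \<delta> p"

lemma \<phi>_ge_1: "1 \<le> \<phi> v"
  using \<delta>_nonneg by (simp add: \<phi>_def rpow_def)

lemma \<phi>_0: "\<phi> 0 = 1"
  using reference by (auto simp: \<phi>_def rpow_def)

lemma F_0: "F 0 = 0"
  by (simp add: F_fun_def)

text \<open>
  At \<open>0\<close> the derivative is one-sided; there the power \<open>v powr (p + 1)\<close> has derivative \<open>0\<close> because
  \<open>p > 0\<close> unless its coefficient vanishes.
\<close>

lemma DERIV_F:
  assumes "0 \<le> v"
  shows "(F has_real_derivative \<phi> v) (at v within {0..})"
proof (cases "\<delta> = 0")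
  case True
  then have "F = (\<lambda>x. x)" "\<phi> v = 1"
    unfolding F_fun_def[abs_def] \<phi>_def by simp_all
  then show ?thesis by simp
next
  case False
  then have p: "0 < p" using reference p_nonneg by force
  have "((\<lambda>v. v powr (p + 1)) has_real_derivative (p + 1) * v powr p) (at v within {0..})"
  proof (cases "v = 0")
    case False
    then show ?thesis
      using assms has_real_derivative_powr[of v "p + 1"]
      by (auto intro: has_field_derivative_at_within)
  next
    case True
    have "((\<lambda>z::real. z powr p) \<longlongrightarrow> 0) (at 0 within {0..})"
      by (rule tendsto_zero_powrI)
         (use p in \<open>auto simp: eventually_at_filter intro!: tendsto_eq_intros\<close>)
    moreover have "\<forall>\<^sub>F z in at 0 within {0..}. z powr p = (z powr (p + 1) - 0 powr (p + 1)) / (z - (0::real))"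
      by (auto simp: eventually_at_filter powr_add)
    ultimately have "((\<lambda>z::real. (z powr (p + 1) - 0 powr (p + 1)) / (z - 0)) \<longlongrightarrow> 0) (at 0 within {0..})"
      by (rule Lim_transform_eventually)
    then show ?thesis using True p by (simp add: has_field_derivative_iff)
  qed
  note [derivative_intros] = this
  show ?thesis
    unfolding F_fun_def[abs_def] \<phi>_def using p
    by (auto intro!: derivative_eq_intros simp: rpow_def)
qed

lemma continuous_on_F: "S \<subseteq> {0..} \<Longrightarrow> continuous_on S F"
  using DERIV_continuous_on[of "{0..}" F \<phi>] DERIV_F continuous_on_subset by auto

text \<open>
  \<open>F\<close> does not contract distances on the half-line, since its nonlinear part is nondecreasing.
  Hence it is injective there, and its inverse is Lipschitz.
\<close>

lemma F_expands:
  assumes "0 \<le> u" "u \<le> v"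
  shows "v - u \<le> F v - F u"
proof -
  have "u powr (p + 1) \<le> v powr (p + 1)"
    using assms p_nonneg by (intro powr_mono2) auto
  then have "\<delta> / (p + 1) * u powr (p + 1) \<le> \<delta> / (p + 1) * v powr (p + 1)"
    using \<delta>_nonneg p_nonneg by (intro mult_left_mono) auto
  then show ?thesis by (simp add: F_fun_def)
qed

lemma F_strict_mono: "0 \<le> u \<Longrightarrow> u < v \<Longrightarrow> F u < F v"
  using F_expands[of u v] by simp

lemma F_inj: "0 \<le> u \<Longrightarrow> 0 \<le> v \<Longrightarrow> F u = F v \<Longrightarrow> u = v"
  using F_strict_mono[of u v] F_strict_mono[of v u] by linarith

lemma dist_le_dist_F: "0 \<le> u \<Longrightarrow> 0 \<le> v \<Longrightarrow> dist u v \<le> dist (F u) (F v)"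
  using F_expands[of u v] F_expands[of v u] by (cases "u \<le> v") (auto simp: dist_real_def)

lemma F_surj:
  assumes "0 \<le> v"
  obtains u where "0 \<le> u" "F u = v"
proof -
  have "\<exists>u. 0 \<le> u \<and> u \<le> v \<and> F u = v"
    using assms F_expands[of 0 v] F_0 by (intro IVT' continuous_on_F) auto
  then show ?thesis using that by blast
qed

lemma lambda0_pos: "0 < lambda0 \<gamma> Ste" (is ?pos)
  and lambda0_eq: "2 * lambda0 \<gamma> Ste * exp ((lambda0 \<gamma> Ste)\<^sup>2) = \<gamma> * Ste" (is ?eq)
proof -
  have pos: "0 < \<gamma> * Ste" using \<gamma>_pos Ste_pos by simp
  have "2 * (\<gamma> * Ste) * 1 \<le> 2 * (\<gamma> * Ste) * exp ((\<gamma> * Ste)\<^sup>2)"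
    using pos by (intro mult_left_mono) auto
  then have "\<exists>x. 0 \<le> x \<and> x \<le> \<gamma> * Ste \<and> 2 * x * exp (x\<^sup>2) = \<gamma> * Ste"
    using pos by (intro IVT') (auto intro!: continuous_intros)
  then obtain x where x: "0 \<le> x" "2 * x * exp (x\<^sup>2) = \<gamma> * Ste" by blast
  then have "0 < x" using pos by (cases "x = 0") auto
  with x(2) have "0 < lambda0 \<gamma> Ste \<and> 2 * lambda0 \<gamma> Ste * exp ((lambda0 \<gamma> Ste)\<^sup>2) = \<gamma> * Ste"
    unfolding lambda0_def
  proof (intro theI[where P = "\<lambda>x. x > 0 \<and> 2 * x * exp (x\<^sup>2) = \<gamma> * Ste"])
    fix z assume "0 < z \<and> 2 * z * exp (z\<^sup>2) = \<gamma> * Ste"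
    with x(2) \<open>0 < x\<close> show "z = x"
      using x_exp_strict_mono[of x z] x_exp_strict_mono[of z x] by linarith
  qed simp
  then show ?pos ?eq by auto
qed

lemma beta_fun_nonneg_iff:
  assumes "0 \<le> x"
  shows "0 \<le> beta_fun \<gamma> Ste x \<longleftrightarrow> x \<le> lambda0 \<gamma> Ste"
proof -
  have "0 \<le> beta_fun \<gamma> Ste x \<longleftrightarrow> 2 * x * exp (x\<^sup>2) \<le> \<gamma> * Ste"
    using \<gamma>_pos Ste_pos by (simp add: beta_fun_def divide_le_eq)
  also have "\<dots> \<longleftrightarrow> x * exp (x\<^sup>2) \<le> lambda0 \<gamma> Ste * exp ((lambda0 \<gamma> Ste)\<^sup>2)"
    using lambda0_eq by linarith
  also have "\<dots> \<longleftrightarrow> x \<le> lambda0 \<gamma> Ste"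
    using x_exp_strict_mono[of x "lambda0 \<gamma> Ste"] x_exp_strict_mono[of "lambda0 \<gamma> Ste" x]
      assms lambda0_pos by (cases x "lambda0 \<gamma> Ste" rule: linorder_cases) auto
  finally show ?thesis .
qed

lemma beta_fun_strict_antimono:
  "0 \<le> x \<Longrightarrow> x < y \<Longrightarrow> beta_fun \<gamma> Ste y < beta_fun \<gamma> Ste x"
  using x_exp_strict_mono[of x y] \<gamma>_pos Ste_pos
  by (simp add: beta_fun_def divide_strict_right_mono)

definition front_eq :: "real \<Rightarrow> bool" where
  "front_eq lam \<longleftrightarrow> 0 < lam \<and> lam \<le> lambda0 \<gamma> Ste \<and>
     Ste / sqrt pi * F (beta_fun \<gamma> Ste lam) = lam * exp (lam\<^sup>2) * erf lam"

text \<open>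
  On \<open>{0..lambda0 \<gamma> Ste}\<close> the left-hand side falls from a positive value to \<open>0\<close>, as \<open>\<beta>\<close> falls from
  \<open>1\<close> to \<open>0\<close>, while the right-hand side rises from \<open>0\<close>. So the two sides are equal exactly once.
\<close>

lemma ex1_front_eq: "\<exists>!lam. front_eq lam"
proof -
  let ?L = "lambda0 \<gamma> Ste"
  let ?d = "\<lambda>x. Ste / sqrt pi * F (beta_fun \<gamma> Ste x) - x * exp (x\<^sup>2) * erf x"
  have beta: "0 \<le> beta_fun \<gamma> Ste x" if "x \<in> {0..?L}" for x
    using that beta_fun_nonneg_iff by auto
  have anti: "?d y < ?d x" if "0 \<le> x" "x < y" "y \<le> ?L" for x y
  proof -
    have "F (beta_fun \<gamma> Ste y) < F (beta_fun \<gamma> Ste x)"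
      using that by (intro F_strict_mono beta beta_fun_strict_antimono) auto
    then have "Ste / sqrt pi * F (beta_fun \<gamma> Ste y) < Ste / sqrt pi * F (beta_fun \<gamma> Ste x)"
      using Ste_pos by (intro mult_strict_left_mono) auto
    moreover have "x * exp (x\<^sup>2) * erf x \<le> y * exp (y\<^sup>2) * erf y"
      using that x_exp_strict_mono[of x y] erf_mono[of x y] erf_mono[of 0 x] erf_0
      by (intro mult_mono) auto
    ultimately show ?thesis by linarith
  qed
  have at_0: "0 < ?d 0"
    using F_strict_mono[of 0 1] Ste_pos by (simp add: beta_fun_def F_0 erf_0)
  have "beta_fun \<gamma> Ste ?L = 0"
    using lambda0_eq \<gamma>_pos Ste_pos by (simp add: beta_fun_def)
  then have at_L: "?d ?L \<le> 0"
    using lambda0_pos erf_mono[of 0 ?L] by (simp add: F_0 erf_0)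
  have "continuous_on {0..?L} (\<lambda>x. F (beta_fun \<gamma> Ste x))"
  proof (rule continuous_on_compose2[of "{0..}" F _ "beta_fun \<gamma> Ste"])
    show "continuous_on {0..} F" by (rule continuous_on_F) simp
    show "continuous_on {0..?L} (beta_fun \<gamma> Ste)"
      unfolding beta_fun_def[abs_def]
      using \<gamma>_pos Ste_pos by (auto intro!: continuous_intros)
  qed (use beta in auto)
  moreover have "continuous_on {0..?L} (\<lambda>x. x * exp (x\<^sup>2) * erf x)"
    using continuous_on_erf by (auto intro!: continuous_on_mult continuous_on_exp continuous_on_power)
  ultimately have "continuous_on {0..?L} ?d"
    by (intro continuous_on_diff continuous_on_mult_left)
  then have "\<exists>x. 0 \<le> x \<and> x \<le> ?L \<and> ?d x = 0"
    using at_0 at_L lambda0_pos by (intro IVT2') auto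
  then obtain lam where lam: "0 \<le> lam" "lam \<le> ?L" "?d lam = 0" by blast
  have "lam \<noteq> 0" using lam(3) at_0 by auto
  then have "front_eq lam" using lam by (auto simp: front_eq_def)
  moreover have "x = y" if "front_eq x" "front_eq y" for x y
    using that anti[of x y] anti[of y x] unfolding front_eq_def
    by (cases x y rule: linorder_cases) auto
  ultimately show ?thesis by blast
qed

text \<open>The Kirchhoff transform \<open>F \<circ> y\<close> of the similarity solution whose front is at \<open>\<eta> = lam\<close>.\<close>

definition kirchhoff :: "real \<Rightarrow> real \<Rightarrow> real" where
  "kirchhoff lam \<eta> = sqrt pi / Ste * lam * exp (lam\<^sup>2) * (erf lam - erf \<eta>)"

lemma kirchhoff_nonneg: "0 \<le> \<eta> \<Longrightarrow> \<eta> \<le> lam \<Longrightarrow> 0 \<le> kirchhoff lam \<eta>"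
  using Ste_pos erf_mono[of \<eta> lam] by (simp add: kirchhoff_def)

lemma DERIV_kirchhoff:
  "(kirchhoff lam has_real_derivative - 2 * lam / Ste * exp (lam\<^sup>2) * exp (- \<eta>\<^sup>2)) (at \<eta>)"
  unfolding kirchhoff_def[abs_def] using Ste_pos
  by (auto intro!: derivative_eq_intros DERIV_erf)

lemma functional_problem_iff:
  "functional_problem \<delta> p \<gamma> Ste y lam \<longleftrightarrow>
     front_eq lam \<and> (\<forall>\<eta>\<in>{0<..<lam}. 0 \<le> y \<eta> \<and> F (y \<eta>) = kirchhoff lam \<eta>)"
  by (auto simp: functional_problem_def front_eq_def kirchhoff_def)

section \<open>The dimensionless boundary value problem\<close>

text \<open>
  What the Stefan problem becomes in the variable \<open>\<eta>\<close>: the heat equation, the Robin condition, the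
  temperature at the front and the Stefan condition, in this order. The derivative \<open>y'\<close> is a
  parameter because it is one-sided at the end points.
\<close>

definition profile :: "(real \<Rightarrow> real) \<Rightarrow> (real \<Rightarrow> real) \<Rightarrow> real \<Rightarrow> bool" where
  "profile y y' lam \<longleftrightarrow>
     0 < lam \<and> (\<forall>\<eta>\<in>{0..lam}. 0 \<le> y \<eta>) \<and>
     (\<forall>\<eta>\<in>{0..lam}. (y has_real_derivative y' \<eta>) (at \<eta> within {0..lam})) \<and>
     (\<forall>\<eta>\<in>{0<..<lam}.
        ((\<lambda>z. \<phi> (y z) * y' z) has_real_derivative - 2 * \<eta> * (\<phi> (y \<eta>) * y' \<eta>)) (at \<eta>)) \<and>
     \<phi> (y 0) * y' 0 = \<gamma> * (y 0 - 1) \<and>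
     y lam = 0 \<and> y' lam = - 2 * lam / Ste"

text \<open>
  The flux \<open>\<phi> (y \<eta>) * y' \<eta>\<close> is the derivative of \<open>F (y \<eta>)\<close>, so the differential equation gives
  \<open>F (y \<eta>) = A + B * erf \<eta>\<close>. The constants come from the two conditions at the front, and the Robin
  condition becomes \<open>y 0 = beta_fun \<gamma> Ste lam\<close>.
\<close>

lemma profile_imp_functional:
  assumes "profile y y' lam"
  shows "front_eq lam" and "\<And>\<eta>. \<eta> \<in> {0..lam} \<Longrightarrow> F (y \<eta>) = kirchhoff lam \<eta>"
proof -
  have lam: "0 < lam" and nonneg: "\<And>\<eta>. \<eta> \<in> {0..lam} \<Longrightarrow> 0 \<le> y \<eta>"
    and y': "\<And>\<eta>. \<eta> \<in> {0..lam} \<Longrightarrow> (y has_real_derivative y' \<eta>) (at \<eta> within {0..lam})"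
    and ode: "\<And>\<eta>. \<eta> \<in> {0<..<lam} \<Longrightarrow>
      ((\<lambda>z. \<phi> (y z) * y' z) has_real_derivative - 2 * \<eta> * (\<phi> (y \<eta>) * y' \<eta>)) (at \<eta>)"
    and robin: "\<phi> (y 0) * y' 0 = \<gamma> * (y 0 - 1)"
    and front: "y lam = 0" "y' lam = - 2 * lam / Ste"
    using assms by (auto simp: profile_def)
  have Fy: "((\<lambda>z. F (y z)) has_real_derivative \<phi> (y \<eta>) * y' \<eta>) (at \<eta> within {0..lam})"
    if "\<eta> \<in> {0..lam}" for \<eta>
  proof -
    have "(F has_real_derivative \<phi> (y \<eta>)) (at (y \<eta>) within y ` {0..lam})"
      using DERIV_F[OF nonneg[OF that]] by (rule DERIV_subset) (use nonneg in auto)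
    from DERIV_image_chain[OF this y'[OF that]] show ?thesis by (simp add: o_def)
  qed
  have Fy_cont: "continuous_on {0..lam} (\<lambda>z. F (y z))"
    by (rule DERIV_continuous_on[OF Fy])
  have Fy_at: "((\<lambda>z. F (y z)) has_real_derivative \<phi> (y \<eta>) * y' \<eta>) (at \<eta>)"
    if "\<eta> \<in> {0<..<lam}" for \<eta>
    using Fy[of \<eta>] that at_within_Icc_at[of 0 \<eta> lam] by auto
  obtain A B where AB: "\<And>\<eta>. \<eta> \<in> {0..lam} \<Longrightarrow> F (y \<eta>) = A + B * erf \<eta>"
    using gaussian_decay_imp_erf[OF lam Fy_cont Fy_at ode] by blast
  \<comment> \<open>One-sided derivatives are unique, so the formula for the flux extends to both end points.\<close>
  have flux: "\<phi> (y \<eta>) * y' \<eta> = B * (2 / sqrt pi * exp (- \<eta>\<^sup>2))" if "\<eta> \<in> {0..lam}" for \<eta>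
  proof (rule has_real_derivative_unique_Icc[OF lam that Fy[OF that]])
    have "((\<lambda>z. A + B * erf z) has_real_derivative B * (2 / sqrt pi * exp (- \<eta>\<^sup>2)))
        (at \<eta> within {0..lam})"
      by (rule has_field_derivative_at_within) (auto intro!: derivative_eq_intros DERIV_erf)
    then show "((\<lambda>z. F (y z)) has_real_derivative B * (2 / sqrt pi * exp (- \<eta>\<^sup>2)))
        (at \<eta> within {0..lam})"
      by (rule has_field_derivative_transform_within[where d = 1]) (use that AB in auto)
  qed
  have "B * (2 / sqrt pi * exp (- lam\<^sup>2)) = - 2 * lam / Ste"
    using flux[of lam] lam front \<phi>_0 by simp
  then have "2 * B = 2 * - (sqrt pi / Ste * lam * exp (lam\<^sup>2))"
    by (simp add: exp_minus field_simps)
  then have B: "B = - (sqrt pi / Ste * lam * exp (lam\<^sup>2))"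
    by linarith
  have A: "A = - B * erf lam"
    using AB[of lam] lam front F_0 by simp
  show F_y: "F (y \<eta>) = kirchhoff lam \<eta>" if "\<eta> \<in> {0..lam}" for \<eta>
  proof -
    have "kirchhoff lam \<eta> = - B * (erf lam - erf \<eta>)"
      by (simp add: B kirchhoff_def)
    then show ?thesis
      using AB[OF that] by (simp add: A algebra_simps)
  qed
  have "\<gamma> * (y 0 - 1) = B * (2 / sqrt pi)"
    using flux[of 0] lam robin by simp
  then have y0: "y 0 = beta_fun \<gamma> Ste lam"
    using \<gamma>_pos Ste_pos by (simp add: B beta_fun_def field_simps)
  show "front_eq lam"
    unfolding front_eq_def
  proof (intro conjI lam)
    show "lam \<le> lambda0 \<gamma> Ste"
      using nonneg[of 0] y0 lam beta_fun_nonneg_iff[of lam] by simp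
    show "Ste / sqrt pi * F (beta_fun \<gamma> Ste lam) = lam * exp (lam\<^sup>2) * erf lam"
      using F_y[of 0] lam Ste_pos by (simp add: y0 kirchhoff_def erf_0)
  qed
qed

text \<open>
  Conversely, \<open>y\<close> inherits continuity from \<open>F \<circ> y\<close> because \<open>F\<close> is expanding, and then
  differentiability by the implicit rule. Multiplying its derivative by \<open>\<phi> (y \<eta>)\<close> leaves an explicit
  Gaussian flux.
\<close>

lemma functional_imp_profile:
  assumes front: "front_eq lam" and nonneg: "\<And>\<eta>. \<eta> \<in> {0..lam} \<Longrightarrow> 0 \<le> y \<eta>"
    and F_y: "\<And>\<eta>. \<eta> \<in> {0..lam} \<Longrightarrow> F (y \<eta>) = kirchhoff lam \<eta>"
  shows "profile y (\<lambda>\<eta>. - 2 * lam / Ste * exp (lam\<^sup>2) * exp (- \<eta>\<^sup>2) / \<phi> (y \<eta>)) lam"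
proof -
  have lam: "0 < lam" "lam \<le> lambda0 \<gamma> Ste"
    and eq: "Ste / sqrt pi * F (beta_fun \<gamma> Ste lam) = lam * exp (lam\<^sup>2) * erf lam"
    using front by (auto simp: front_eq_def)
  define v where "v \<eta> = - 2 * lam / Ste * exp (lam\<^sup>2) * exp (- \<eta>\<^sup>2)" for \<eta>
  have \<phi>_ne: "\<phi> u \<noteq> 0" for u using \<phi>_ge_1[of u] by simp
  have V': "(kirchhoff lam has_real_derivative v \<eta>) (at \<eta> within S)" for \<eta> S
    unfolding v_def by (rule has_field_derivative_at_within[OF DERIV_kirchhoff])
  have "(y has_real_derivative v \<eta> / \<phi> (y \<eta>)) (at \<eta> within {0..lam})" if \<eta>: "\<eta> \<in> {0..lam}" for \<eta>
  proof (rule has_field_derivative_implicit_within[OF DERIV_F _ _ _ V' _ \<eta>])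
    have "dist (y z) (y \<eta>) \<le> dist (kirchhoff lam z) (kirchhoff lam \<eta>)" if "z \<in> {0..lam}" for z
      using dist_le_dist_F[of "y z" "y \<eta>"] nonneg F_y \<eta> that by simp
    moreover have "continuous (at \<eta> within {0..lam}) (kirchhoff lam)"
      by (rule DERIV_continuous[OF V'])
    ultimately show "continuous (at \<eta> within {0..lam}) y"
      unfolding continuous_within_eps_delta by (meson order_le_less_trans)
  qed (use \<phi>_ne nonneg F_y \<eta> in auto)
  moreover have "((\<lambda>z. \<phi> (y z) * (v z / \<phi> (y z))) has_real_derivative
      - 2 * \<eta> * (\<phi> (y \<eta>) * (v \<eta> / \<phi> (y \<eta>)))) (at \<eta>)" for \<eta>
    using \<phi>_ne Ste_pos unfolding v_def by (auto intro!: derivative_eq_intros)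
  moreover have "y lam = 0"
    by (rule F_inj) (use nonneg F_y[of lam] lam F_0 in \<open>auto simp: kirchhoff_def\<close>)
  moreover from this have "v lam / \<phi> (y lam) = - 2 * lam / Ste"
    by (simp add: v_def \<phi>_0 exp_minus)
  moreover have "y 0 = beta_fun \<gamma> Ste lam"
  proof (rule F_inj)
    show "0 \<le> beta_fun \<gamma> Ste lam" using lam beta_fun_nonneg_iff by simp
    show "F (y 0) = F (beta_fun \<gamma> Ste lam)"
    proof -
      have "Ste / sqrt pi * F (y 0) = Ste / sqrt pi * F (beta_fun \<gamma> Ste lam)"
        using F_y[of 0] eq lam Ste_pos by (simp add: kirchhoff_def erf_0)
      then show ?thesis using Ste_pos by simp
    qed
  qed (use nonneg lam in auto)
  then have "\<phi> (y 0) * (v 0 / \<phi> (y 0)) = \<gamma> * (y 0 - 1)"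
    using \<phi>_ne \<gamma>_pos by (simp add: v_def beta_fun_def)
  ultimately show ?thesis
    using lam nonneg unfolding profile_def v_def by blast
qed

end
section \<open>Similarity solutions of the Stefan problem\<close>

locale stefan_problem =
  fixes \<rho> l k0 c0 h T0 Tf \<delta> p a Ste \<gamma> :: real and k c :: "real \<Rightarrow> real"
  assumes \<rho>_pos: "0 < \<rho>" and l_pos: "0 < l" and k0_pos: "0 < k0" and c0_pos: "0 < c0"
    and h_pos: "0 < h" and Tf_less_T0: "Tf < T0" and \<delta>_ge_0: "0 \<le> \<delta>" and p_ge_0: "0 \<le> p"
    and a_def: "a = sqrt (k0 / (\<rho> * c0))"
    and Ste_def: "Ste = c0 * (T0 - Tf) / l"
    and \<gamma>_def: "\<gamma> = 2 * h * a / k0"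
    and k_def: "k = thermal_coeff k0 \<delta> p T0 Tf" and k_Tf: "k Tf = k0"
    and c_def: "c = thermal_coeff c0 \<delta> p T0 Tf"
begin

lemma a_pos: "0 < a"
  using \<rho>_pos k0_pos c0_pos by (simp add: a_def)

lemma k0_eq: "k0 = \<rho> * c0 * (a * a)"
  using \<rho>_pos k0_pos c0_pos by (simp add: a_def flip: power2_eq_square)

end

sublocale stefan_problem \<subseteq> stefan_numbers
proof
  show "\<delta> = 0" if "p = 0"
    using k_Tf k0_pos that by (simp add: k_def thermal_coeff_def rpow_def)
  show "0 < \<gamma>"
    using a_pos h_pos k0_pos by (simp add: \<gamma>_def)
  show "0 < Ste"
    using c0_pos l_pos Tf_less_T0 by (simp add: Ste_def)
qed (fact \<delta>_ge_0 p_ge_0)+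

context stefan_problem
begin

definition temperature :: "(real \<Rightarrow> real) \<Rightarrow> real \<Rightarrow> real \<Rightarrow> real" where
  "temperature y x t = (T0 - Tf) * y (x / (2 * a * sqrt t)) + Tf"

definition front :: "real \<Rightarrow> real \<Rightarrow> real" where
  "front lam t = 2 * a * lam * sqrt t"

lemma k_affine: "k ((T0 - Tf) * v + Tf) = k0 * \<phi> v"
  and c_affine: "c ((T0 - Tf) * v + Tf) = c0 * \<phi> v"
  using Tf_less_T0 by (simp_all add: k_def c_def thermal_coeff_def \<phi>_def)

lemma DERIV_temperature_time:
  assumes t: "0 < t" and y: "(y has_real_derivative y') (at (x / (2 * a * sqrt t)))"
  shows "(temperature y x has_real_derivative
    (T0 - Tf) * (y' * (- (x / (2 * a * sqrt t)) / (2 * t)))) (at t)"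
proof -
  have "((\<lambda>\<tau>. x / (2 * a * sqrt \<tau>)) has_real_derivative - (x / (2 * a * sqrt t)) / (2 * t)) (at t)"
    using t a_pos by (auto intro!: derivative_eq_intros simp: field_simps)
  from DERIV_chain2[OF y this] show ?thesis
    unfolding temperature_def[abs_def] by (auto intro!: derivative_eq_intros)
qed

lemma DERIV_front:
  assumes "0 < t"
  shows "(front lam has_real_derivative a * lam / sqrt t) (at t)"
  unfolding front_def[abs_def] using assms
  by (auto intro!: derivative_eq_intros simp: field_simps)

lemma similarity_type_iff:
  "similarity_type a T0 Tf T s \<longleftrightarrow>
     (\<exists>y lam. 0 < lam \<and> (\<forall>\<eta>\<in>{0..lam}. 0 \<le> y \<eta>) \<and> (\<forall>t>0. s t = front lam t) \<and>
        (\<forall>t>0. \<forall>x\<in>{0..s t}. T x t = temperature y x t))"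
  unfolding similarity_type_def temperature_def front_def by blast

lemma in_front_iff:
  assumes "0 < t"
  shows "x \<in> {0..front lam t} \<longleftrightarrow> x / (2 * a * sqrt t) \<in> {0..lam}"
    and "x \<in> {0<..<front lam t} \<longleftrightarrow> x / (2 * a * sqrt t) \<in> {0<..<lam}"
  using assms a_pos by (auto simp: front_def field_simps)

text \<open>
  Each equation of the Stefan problem at time \<open>t\<close> is its dimensionless counterpart up to a constant
  factor and a power of \<open>t\<close>; the constants match because \<open>a\<^sup>2 = k0 / (\<rho> c0)\<close>.
\<close>

lemma profile_imp_stefan_solution:
  assumes "profile y y' lam"
  shows "stefan_solution k c \<rho> l k0 h T0 Tf (temperature y) (front lam)"
proof -
  have lam: "0 < lam"
    and y': "\<And>\<eta>. \<eta> \<in> {0..lam} \<Longrightarrow> (y has_real_derivative y' \<eta>) (at \<eta> within {0..lam})"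
    and ode: "\<And>\<eta>. \<eta> \<in> {0<..<lam} \<Longrightarrow>
      ((\<lambda>z. \<phi> (y z) * y' z) has_real_derivative - 2 * \<eta> * (\<phi> (y \<eta>) * y' \<eta>)) (at \<eta>)"
    and robin: "\<phi> (y 0) * y' 0 = \<gamma> * (y 0 - 1)"
    and front: "y lam = 0" "y' lam = - 2 * lam / Ste"
    using assms by (auto simp: profile_def)
  define Tx where "Tx x t = (T0 - Tf) * (y' (x / (2 * a * sqrt t)) * (1 / (2 * a * sqrt t)))" for x t
  have space: "((\<lambda>z. temperature y z t) has_real_derivative Tx x t) (at x within {0..front lam t})"
    if t: "0 < t" and x: "x \<in> {0..front lam t}" for t x
  proof -
    let ?r = "2 * a * sqrt t"
    have "(y has_real_derivative y' (x / ?r)) (at (x / ?r) within (\<lambda>z. z / ?r) ` {0..front lam t})"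
      by (rule DERIV_subset[OF y']) (use x t in_front_iff(1) in blast)+
    moreover have "((\<lambda>z. z / ?r) has_real_derivative 1 / ?r) (at x within {0..front lam t})"
      using t a_pos by (auto intro!: derivative_eq_intros)
    ultimately have "((\<lambda>z. y (z / ?r)) has_real_derivative y' (x / ?r) * (1 / ?r))
        (at x within {0..front lam t})"
      using DERIV_image_chain by (fastforce simp: o_def)
    then show ?thesis
      unfolding temperature_def Tx_def by (auto intro!: derivative_eq_intros)
  qed
  have heat: "\<exists>Tt. (temperature y x has_real_derivative Tt) (at t) \<and>
      ((\<lambda>z. k (temperature y z t) * Tx z t) has_real_derivative \<rho> * c (temperature y x t) * Tt) (at x)"
    if t: "0 < t" and x: "x \<in> {0<..<front lam t}" for t x
  proof -
    define r where "r = 2 * a * sqrt t"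
    have r: "0 < r" "r * r = 4 * (a * a) * t"
      using t a_pos by (auto simp: r_def)
    define \<eta> where "\<eta> = x / r"
    have \<eta>: "\<eta> \<in> {0<..<lam}" using in_front_iff(2)[OF t] x by (simp add: \<eta>_def r_def)
    define Tt where "Tt = (T0 - Tf) * (y' \<eta> * (- \<eta> / (2 * t)))"
    have "(y has_real_derivative y' \<eta>) (at \<eta>)"
      using y'[of \<eta>] \<eta> at_within_Icc_at[of 0 \<eta> lam] by auto
    then have "(temperature y x has_real_derivative Tt) (at t)"
      using DERIV_temperature_time[OF t, of y "y' \<eta>" x] by (simp add: Tt_def \<eta>_def r_def)
    moreover have "((\<lambda>z. k (temperature y z t) * Tx z t) has_real_derivative
        \<rho> * c (temperature y x t) * Tt) (at x)"
    proof -
      have "((\<lambda>z. z / r) has_real_derivative 1 / r) (at x)"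
        by (rule DERIV_cdivide) simp
      from DERIV_chain2[OF ode[OF \<eta>, unfolded \<eta>_def] this]
      have "((\<lambda>z. k0 * (T0 - Tf) / r * (\<phi> (y (z / r)) * y' (z / r))) has_real_derivative
          k0 * (T0 - Tf) / r * (- 2 * \<eta> * (\<phi> (y \<eta>) * y' \<eta>) * (1 / r))) (at x)"
        unfolding \<eta>_def by (rule DERIV_cmult)
      moreover have "k0 * (T0 - Tf) / r * (- 2 * \<eta> * (\<phi> (y \<eta>) * y' \<eta>) * (1 / r)) =
          \<rho> * c (temperature y x t) * Tt"
      proof -
        have "k0 * (T0 - Tf) / r * (- 2 * \<eta> * (\<phi> (y \<eta>) * y' \<eta>) * (1 / r)) =
            k0 / (r * r) * (- 2 * ((T0 - Tf) * (\<eta> * (\<phi> (y \<eta>) * y' \<eta>))))"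
          by (simp add: mult_ac)
        also have "k0 / (r * r) = \<rho> * c0 / (4 * t)"
          using a_pos t by (simp add: r(2) k0_eq)
        finally show ?thesis
          by (simp add: temperature_def c_affine Tt_def flip: r_def \<eta>_def)
      qed
      moreover have "k (temperature y z t) * Tx z t =
          k0 * (T0 - Tf) / r * (\<phi> (y (z / r)) * y' (z / r))" for z
        by (simp add: temperature_def k_affine Tx_def flip: r_def)
      ultimately show ?thesis by simp
    qed
    ultimately show ?thesis by blast
  qed
  have robin': "k (temperature y 0 t) * Tx 0 t = h / sqrt t * (temperature y 0 t - T0)"
    if t: "0 < t" for t
  proof -
    have "k (temperature y 0 t) * Tx 0 t = k0 * (T0 - Tf) / (2 * a * sqrt t) * (\<phi> (y 0) * y' 0)"
      by (simp add: temperature_def k_affine Tx_def)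
    also have "\<dots> = h / sqrt t * ((T0 - Tf) * (y 0 - 1))"
      unfolding robin \<gamma>_def using k0_pos a_pos t by simp
    finally show ?thesis by (simp add: temperature_def algebra_simps)
  qed
  have at_front: "front lam t / (2 * a * sqrt t) = lam" if "0 < t" for t
    using that a_pos by (simp add: front_def)
  have stefan: "k0 * Tx (front lam t) t = - \<rho> * l * (a * lam / sqrt t)" if t: "0 < t" for t
    using t a_pos l_pos c0_pos Tf_less_T0
    unfolding Tx_def at_front[OF t] front(2) Ste_def by (simp add: k0_eq field_simps)
  show ?thesis
    unfolding stefan_solution_def
  proof (intro conjI exI[of _ Tx] allI impI ballI)
    show "front lam 0 = 0" by (simp add: front_def)
    show "0 < front lam t" if "0 < t" for t using lam a_pos that by (simp add: front_def)
    show "temperature y (front lam t) t = Tf" if "0 < t" for t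
      using at_front[OF that] front(1) by (simp add: temperature_def)
    show "\<exists>ds. (front lam has_real_derivative ds) (at t) \<and> k0 * Tx (front lam t) t = - \<rho> * l * ds"
      if "0 < t" for t
      using DERIV_front[OF that] stefan[OF that] by blast
  qed (use space heat robin' in auto)
qed

text \<open>
  By self-similarity the equations at \<open>t = 1\<close> carry all the information; there \<open>x = 2 a \<eta>\<close>, and \<open>y\<close> is
  the temperature up to an affine change of scale.
\<close>

lemma stefan_solution_imp_profile:
  assumes sol: "stefan_solution k c \<rho> l k0 h T0 Tf T s"
    and lam: "0 < lam" and nonneg: "\<forall>\<eta>\<in>{0..lam}. 0 \<le> y \<eta>"
    and s: "\<forall>t>0. s t = front lam t"
    and T: "\<forall>t>0. \<forall>x\<in>{0..s t}. T x t = temperature y x t"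
  obtains y' where "profile y y' lam"
proof -
  define D where "D = T0 - Tf"
  have D: "0 < D" using Tf_less_T0 by (simp add: D_def)
  have s1: "s 1 = 2 * a * lam" using s by (simp add: front_def)
  have T1: "T (2 * a * \<eta>) 1 = D * y \<eta> + Tf" if "\<eta> \<in> {0..lam}" for \<eta>
    using T[rule_format, of 1 "2 * a * \<eta>"] that a_pos by (simp add: s1 temperature_def D_def)
  obtain Tx where
      "\<forall>t>0. \<forall>x\<in>{0..s t}. ((\<lambda>z. T z t) has_real_derivative Tx x t) (at x within {0..s t})"
      "\<forall>t>0. \<forall>x\<in>{0<..<s t}. \<exists>Tt. (T x has_real_derivative Tt) (at t) \<and>
        ((\<lambda>z. k (T z t) * Tx z t) has_real_derivative \<rho> * c (T x t) * Tt) (at x)"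
      "\<forall>t>0. k (T 0 t) * Tx 0 t = h / sqrt t * (T 0 t - T0)"
      "\<forall>t>0. T (s t) t = Tf"
      "\<forall>t>0. \<exists>ds. (s has_real_derivative ds) (at t) \<and> k0 * Tx (s t) t = - \<rho> * l * ds"
    using sol unfolding stefan_solution_def by auto
  note at_1 = this[rule_format, OF zero_less_one]
  have space: "\<And>x. x \<in> {0..s 1} \<Longrightarrow> ((\<lambda>z. T z 1) has_real_derivative Tx x 1) (at x within {0..s 1})"
    and heat: "\<And>x. x \<in> {0<..<s 1} \<Longrightarrow> \<exists>Tt. (T x has_real_derivative Tt) (at 1) \<and>
        ((\<lambda>z. k (T z 1) * Tx z 1) has_real_derivative \<rho> * c (T x 1) * Tt) (at x)"
    and robin: "k (T 0 1) * Tx 0 1 = h * (T 0 1 - T0)"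
    and front: "T (s 1) 1 = Tf"
    and stefan: "\<exists>ds. (s has_real_derivative ds) (at 1) \<and> k0 * Tx (s 1) 1 = - \<rho> * l * ds"
    using at_1 by simp_all
  define y' where "y' \<eta> = 2 * a / D * Tx (2 * a * \<eta>) 1" for \<eta>
  have deriv: "(y has_real_derivative y' \<eta>) (at \<eta> within {0..lam})" if \<eta>: "\<eta> \<in> {0..lam}" for \<eta>
  proof -
    have "((\<lambda>z. T z 1) has_real_derivative Tx (2 * a * \<eta>) 1)
        (at (2 * a * \<eta>) within (\<lambda>z. 2 * a * z) ` {0..lam})"
      by (rule DERIV_subset[OF space]) (use \<eta> a_pos in \<open>auto simp: s1\<close>)
    moreover have "((\<lambda>z. 2 * a * z) has_real_derivative 2 * a) (at \<eta> within {0..lam})"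
      by (auto intro!: derivative_eq_intros)
    ultimately have "((\<lambda>z. T (2 * a * z) 1) has_real_derivative Tx (2 * a * \<eta>) 1 * (2 * a))
        (at \<eta> within {0..lam})"
      using DERIV_image_chain by (fastforce simp: o_def)
    then have "((\<lambda>z. (T (2 * a * z) 1 - Tf) / D) has_real_derivative y' \<eta>) (at \<eta> within {0..lam})"
      unfolding y'_def using D by (auto intro!: derivative_eq_intros)
    then show ?thesis
      by (rule has_field_derivative_transform_within[where d = 1]) (use \<eta> T1 D in auto)
  qed
  have flux: "k (T (2 * a * \<eta>) 1) * Tx (2 * a * \<eta>) 1 = k0 * D / (2 * a) * (\<phi> (y \<eta>) * y' \<eta>)"
    if "\<eta> \<in> {0..lam}" for \<eta>
    using D a_pos by (simp add: T1[OF that] y'_def k_affine[folded D_def])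
  have ode: "((\<lambda>z. \<phi> (y z) * y' z) has_real_derivative - 2 * \<eta> * (\<phi> (y \<eta>) * y' \<eta>)) (at \<eta>)"
    if \<eta>: "\<eta> \<in> {0<..<lam}" for \<eta>
  proof -
    define x where "x = 2 * a * \<eta>"
    have x: "x \<in> {0<..<s 1}" using \<eta> a_pos by (simp add: x_def s1)
    obtain Tt where Tt: "(T x has_real_derivative Tt) (at 1)"
      and flux_x: "((\<lambda>z. k (T z 1) * Tx z 1) has_real_derivative \<rho> * c (T x 1) * Tt) (at x)"
      using heat[OF x] by blast
    \<comment> \<open>The point \<open>x\<close> stays behind the front for times near \<open>1\<close>, so the time derivative is that of the
       similarity form.\<close>
    have "\<forall>\<^sub>F \<tau> in nhds 1. T x \<tau> = temperature y x \<tau>"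
    proof -
      have "isCont (front lam) 1" using DERIV_front[of 1] DERIV_isCont by auto
      moreover have "x < front lam 1" using x s by simp
      ultimately have "\<forall>\<^sub>F \<tau> in nhds 1. x < front lam \<tau>"
        unfolding continuous_within tendsto_at_iff_tendsto_nhds by (rule order_tendstoD(1))
      moreover have "\<forall>\<^sub>F \<tau> in nhds 1. (0::real) < \<tau>"
        by (rule eventually_nhds_in_open[of "{0<..}", simplified]) auto
      ultimately show ?thesis
        by eventually_elim (use T s x in auto)
    qed
    then have "(temperature y x has_real_derivative Tt) (at 1)"
      using Tt DERIV_cong_ev[OF refl _ refl] by blast
    moreover have "(y has_real_derivative y' \<eta>) (at \<eta>)"
      using deriv[of \<eta>] \<eta> at_within_Icc_at[of 0 \<eta> lam] by auto
    then have "(temperature y x has_real_derivative D * (y' \<eta> * (- \<eta> / 2))) (at 1)"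
      using DERIV_temperature_time[of 1 y "y' \<eta>" x] a_pos by (simp add: x_def D_def)
    ultimately have Tt_eq: "Tt = D * (y' \<eta> * (- \<eta> / 2))"
      by (rule DERIV_unique)
    have "((\<lambda>z. 2 * a * z) has_real_derivative 2 * a) (at \<eta>)"
      by (auto intro!: derivative_eq_intros)
    from DERIV_chain2[OF flux_x[unfolded x_def] this]
    have "((\<lambda>z. 2 * a / (k0 * D) * (k (T (2 * a * z) 1) * Tx (2 * a * z) 1)) has_real_derivative
        2 * a / (k0 * D) * (\<rho> * c (T x 1) * Tt * (2 * a))) (at \<eta>)"
      unfolding x_def by (rule DERIV_cmult)
    moreover have "2 * a / (k0 * D) * (\<rho> * c (T x 1) * Tt * (2 * a)) = - 2 * \<eta> * (\<phi> (y \<eta>) * y' \<eta>)"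
      using D \<eta> a_pos \<rho>_pos c0_pos
      by (simp add: x_def T1 c_affine[folded D_def] Tt_eq k0_eq)
    ultimately have "((\<lambda>z. 2 * a / (k0 * D) * (k (T (2 * a * z) 1) * Tx (2 * a * z) 1))
        has_real_derivative - 2 * \<eta> * (\<phi> (y \<eta>) * y' \<eta>)) (at \<eta>)"
      by simp
    then show ?thesis
      by (rule has_field_derivative_transform_within_open[of _ _ _ "{0<..<lam}"])
         (use \<eta> flux D a_pos k0_pos in auto)
  qed
  have "T 0 1 - T0 = D * (y 0 - 1)"
    using T1[of 0] lam by (simp add: D_def algebra_simps)
  then have "k0 * D / (2 * a) * (\<phi> (y 0) * y' 0) = h * (D * (y 0 - 1))"
    using robin flux[of 0] lam by simp
  then have "D * (k0 / (2 * a) * (\<phi> (y 0) * y' 0)) = D * (h * (y 0 - 1))"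
    by (simp add: mult_ac)
  then have "k0 / (2 * a) * (\<phi> (y 0) * y' 0) = h * (y 0 - 1)"
    using D mult_left_cancel[of D] by blast
  then have robin': "\<phi> (y 0) * y' 0 = \<gamma> * (y 0 - 1)"
    using a_pos k0_pos by (simp add: \<gamma>_def field_simps)
  have y_lam: "y lam = 0"
    using front T1[of lam] lam D by (simp add: s1)
  obtain ds where ds: "(s has_real_derivative ds) (at 1)" "k0 * Tx (s 1) 1 = - \<rho> * l * ds"
    using stefan by blast
  have "\<forall>\<^sub>F \<tau> in nhds 1. (0::real) < \<tau>"
    by (rule eventually_nhds_in_open[of "{0<..}", simplified]) auto
  then have "\<forall>\<^sub>F \<tau> in nhds 1. s \<tau> = front lam \<tau>"
    by eventually_elim (use s in auto)
  then have "(front lam has_real_derivative ds) (at 1)"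
    using ds(1) DERIV_cong_ev[OF refl _ refl] by blast
  then have "ds = a * lam"
    using DERIV_unique DERIV_front[of 1 lam] by fastforce
  then have "\<rho> * a * (a * c0 * Tx (2 * a * lam) 1) = \<rho> * a * (- l * lam)"
    using ds(2) by (simp add: s1 k0_eq mult_ac)
  then have "a * c0 * Tx (2 * a * lam) 1 = - l * lam"
    by (rule mult_left_cancel[THEN iffD1, rotated]) (use \<rho>_pos a_pos in simp)
  then have y'_lam: "y' lam = - 2 * lam / Ste"
    using D c0_pos l_pos by (simp add: y'_def Ste_def field_simps flip: D_def)
  have "profile y y' lam"
    unfolding profile_def using lam nonneg deriv ode robin' y_lam y'_lam by blast
  then show ?thesis by (rule that)
qed

end

theorem theorem3p5:
  fixes \<rho> l k0 c0 h T0 Tf \<delta> p a Ste \<gamma> :: real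
    and k c :: "real \<Rightarrow> real"
  assumes "\<rho> > 0" "l > 0" "k0 > 0" "c0 > 0" "h > 0" "T0 > 0" "Tf < T0" "\<delta> \<ge> 0" "p \<ge> 0"
    and "a = sqrt (k0 / (\<rho> * c0))"
    and "Ste = c0 * (T0 - Tf) / l"
    and "\<gamma> = 2 * h * a / k0"
    and "k = thermal_coeff k0 \<delta> p T0 Tf" and "k Tf = k0"
    and "c = thermal_coeff c0 \<delta> p T0 Tf" and "c Tf = c0"
  shows "\<exists>y\<gamma> lam\<gamma>.
    functional_problem \<delta> p \<gamma> Ste y\<gamma> lam\<gamma> \<and>
    (\<forall>y lam. functional_problem \<delta> p \<gamma> Ste y lam \<longrightarrow> lam = lam\<gamma> \<and> (\<forall>\<eta>\<in>{0<..<lam\<gamma>}. y \<eta> = y\<gamma> \<eta>)) \<and>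
    (\<exists>T\<gamma> s\<gamma>.
      stefan_solution k c \<rho> l k0 h T0 Tf T\<gamma> s\<gamma> \<and> similarity_type a T0 Tf T\<gamma> s\<gamma> \<and>
      (\<forall>t>0. s\<gamma> t = 2 * a * lam\<gamma> * sqrt t) \<and>
      (\<forall>t>0. \<forall>x\<in>{0<..<s\<gamma> t}. T\<gamma> x t = (T0 - Tf) * y\<gamma> (x / (2 * a * sqrt t)) + Tf) \<and>
      (\<forall>T s. stefan_solution k c \<rho> l k0 h T0 Tf T s \<and> similarity_type a T0 Tf T s \<longrightarrow>
         (\<forall>t\<ge>0. s t = s\<gamma> t) \<and> (\<forall>t>0. \<forall>x\<in>{0..s\<gamma> t}. T x t = T\<gamma> x t)))"
proof -
  interpret stefan_problem \<rho> l k0 c0 h T0 Tf \<delta> p a Ste \<gamma> k c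
    by unfold_locales (use assms in auto)
  obtain lam where lam: "front_eq lam" and lam_unique: "\<And>lam'. front_eq lam' \<Longrightarrow> lam' = lam"
    using ex1_front_eq by blast
  have "\<forall>\<eta>\<in>{0..lam}. \<exists>u. 0 \<le> u \<and> F u = kirchhoff lam \<eta>"
    using kirchhoff_nonneg F_surj by (metis atLeastAtMost_iff)
  then obtain y where y: "\<forall>\<eta>\<in>{0..lam}. 0 \<le> y \<eta> \<and> F (y \<eta>) = kirchhoff lam \<eta>"
    by (rule bchoice[THEN exE])
  have y_unique: "y' \<eta> = y \<eta>"
    if "\<eta> \<in> {0..lam}" "0 \<le> y' \<eta>" "F (y' \<eta>) = kirchhoff lam \<eta>" for y' :: "real \<Rightarrow> real" and \<eta>
    using F_inj that y by metis
  have problem: "functional_problem \<delta> p \<gamma> Ste y lam"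
    unfolding functional_problem_iff using lam y by auto
  have problem_unique: "lam' = lam \<and> (\<forall>\<eta>\<in>{0<..<lam}. y' \<eta> = y \<eta>)"
    if "functional_problem \<delta> p \<gamma> Ste y' lam'" for y' lam'
    using that lam_unique y_unique unfolding functional_problem_iff by fastforce
  have "0 < lam" using lam by (simp add: front_eq_def)
  have sol: "stefan_solution k c \<rho> l k0 h T0 Tf (temperature y) (front lam)"
    by (rule profile_imp_stefan_solution[OF functional_imp_profile[OF lam]]) (use y in auto)
  have sim: "similarity_type a T0 Tf (temperature y) (front lam)"
    unfolding similarity_type_iff using \<open>0 < lam\<close> y by blast
  have sol_unique: "(\<forall>t\<ge>0. s t = front lam t) \<and> (\<forall>t>0. \<forall>x\<in>{0..front lam t}. T x t = temperature y x t)"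
    if sol': "stefan_solution k c \<rho> l k0 h T0 Tf T s" and sim': "similarity_type a T0 Tf T s" for T s
  proof -
    obtain z lam' where z: "0 < lam'" "\<forall>\<eta>\<in>{0..lam'}. 0 \<le> z \<eta>" "\<forall>t>0. s t = front lam' t"
      "\<forall>t>0. \<forall>x\<in>{0..s t}. T x t = temperature z x t"
      using sim' unfolding similarity_type_iff by blast
    obtain z' where prof: "profile z z' lam'"
      using stefan_solution_imp_profile[OF sol' z] .
    have lam': "lam' = lam"
      using profile_imp_functional(1)[OF prof] lam_unique by blast
    have "z \<eta> = y \<eta>" if "\<eta> \<in> {0..lam}" for \<eta>
      using y_unique[OF that] z(2) profile_imp_functional(2)[OF prof] that lam' by simp
    then have "temperature z x t = temperature y x t" if "0 < t" "x \<in> {0..front lam t}" for x t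
      using in_front_iff(1)[OF that(1)] that(2) by (simp add: temperature_def)
    moreover have "s 0 = front lam 0"
      using sol' by (simp add: stefan_solution_def front_def)
    ultimately show ?thesis
      using z(3,4) lam' by (metis order_le_less)
  qed
  show ?thesis
  proof (rule exI[of _ y], rule exI[of _ lam], intro conjI)
    show "\<exists>T\<gamma> s\<gamma>.
      stefan_solution k c \<rho> l k0 h T0 Tf T\<gamma> s\<gamma> \<and> similarity_type a T0 Tf T\<gamma> s\<gamma> \<and>
      (\<forall>t>0. s\<gamma> t = 2 * a * lam * sqrt t) \<and>
      (\<forall>t>0. \<forall>x\<in>{0<..<s\<gamma> t}. T\<gamma> x t = (T0 - Tf) * y (x / (2 * a * sqrt t)) + Tf) \<and>
      (\<forall>T s. stefan_solution k c \<rho> l k0 h T0 Tf T s \<and> similarity_type a T0 Tf T s \<longrightarrow>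
         (\<forall>t\<ge>0. s t = s\<gamma> t) \<and> (\<forall>t>0. \<forall>x\<in>{0..s\<gamma> t}. T x t = T\<gamma> x t))"
    proof (rule exI[of _ "temperature y"], rule exI[of _ "front lam"], intro conjI)
      show "\<forall>t>0. front lam t = 2 * a * lam * sqrt t"
        by (simp add: front_def)
      show "\<forall>t>0. \<forall>x\<in>{0<..<front lam t}.
          temperature y x t = (T0 - Tf) * y (x / (2 * a * sqrt t)) + Tf"
        by (simp add: temperature_def)
    qed (use sol sim sol_unique in blast)+
  qed (use problem problem_unique in blast)+
qed

end
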